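(* For any sequence $(M_n)_{n\in\mathbb{N}}\in\{C_1,C_2\}^{\mathbb{N}}$, there exists a vector $\mathbf{u}\in\mathbb{R}^3_{\geq0}\setminus\{0\}$ satisfying $$\bigcap_{n\geq0} M_{[0,n)}\,\mathbb{R}^3_{\geq0}=\mathbb{R}_{\geq0}\mathbf{u}.$$
   Context: $C_1=\begin{pmatrix}1&1&0\\0&0&1\\0&1&0\end{pmatrix}$, $C_2=\begin{pmatrix}0&1&0\\1&0&0\\0&1&1\end{pmatrix}$, and $M_{[0,n)}=M_0M_1\cdots M_{n-1}$ (the identity for $n=0$). *)

theory Defs
  imports "HOL-Analysis.Analysis"
begin

text \<open>Matrices are given by their rows: \<open>A $ i $ j\<close> is the entry in row \<open>i\<close>, column \<open>j\<close>.\<close>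

definition C1 :: "real^3^3" where
  "C1 = vector [vector [1, 1, 0],
                vector [0, 0, 1],
                vector [0, 1, 0]]"

definition C2 :: "real^3^3" where
  "C2 = vector [vector [0, 1, 0],
                vector [1, 0, 0],
                vector [0, 1, 1]]"

text \<open>\<open>mat_prod M n\<close> is \<open>M\<^sub>0 M\<^sub>1 \<dots> M\<^sub>n\<^sub>-\<^sub>1\<close>; new factors are multiplied on the right.\<close>

primrec mat_prod :: "(nat \<Rightarrow> real^3^3) \<Rightarrow> nat \<Rightarrow> real^3^3" where
  "mat_prod M 0 = mat 1"
| "mat_prod M (Suc n) = mat_prod M n ** M n"

definition nonneg_orthant :: "(real^3) set" where
  "nonneg_orthant = {x. \<forall>i. 0 \<le> x $ i}"

end

theory Submission
  imports Defs
begin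

text \<open>
  Applying the inverse matrices to a vector \<open>x\<close> of the intersection gives an infinite orbit of
  nonnegative vectors of a subtractive algorithm, which compares the first and the third
  coordinate. If the sequence of matrices is eventually constant, two coordinates of the orbit
  vanish. Otherwise two orbits \<open>x\<close>, \<open>y\<close> following the same sequence of matrices satisfy
  \<open>x\<^sub>j y\<^sub>i \<le> 10 x\<^sub>i y\<^sub>j\<close> at every time: if this failed, the coordinate \<open>i\<close> or \<open>j\<close> would be
  trapped in the middle position at every second step and never decrease, while being subtracted
  infinitely often from the others. So the intersection has finite diameter in the Hilbert metric
  of the orthant, uniformly in time, which forces any two of its elements to be parallel:
  otherwise \<open>x - t y\<close> with \<open>t\<close> maximal would still dominate a positive multiple of \<open>y\<close>.
\<close>

section \<open>Orbits of the subtractive algorithm\<close>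

text \<open>The inverse of \<open>C1\<close> if \<open>b\<close> holds and of \<open>C2\<close>
  otherwise, written out in coordinates.\<close>

definition inv_step :: "bool \<Rightarrow> real^3 \<Rightarrow> real^3" where
  "inv_step b v = (if b then vector [v $ 1 - v $ 3, v $ 3, v $ 2]
                   else vector [v $ 2, v $ 1, v $ 3 - v $ 1])"

primrec orb :: "(nat \<Rightarrow> bool) \<Rightarrow> nat \<Rightarrow> real^3 \<Rightarrow> real^3" where
  "orb s 0 v = v"
| "orb s (Suc n) v = inv_step (s n) (orb s n v)"

text \<open>Nonnegativity of the whole infinite orbit of \<open>(a, b, c)\<close>. Three real
  arguments and coinduction reduce each step to arithmetic on coordinates, with the sequence shifted
  instead of a time index.\<close>

coinductive admissible :: "(nat \<Rightarrow> bool) \<Rightarrow> real \<Rightarrow> real \<Rightarrow> real \<Rightarrow> bool" where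
  admissibleI: "\<lbrakk>0 \<le> a; 0 \<le> b; 0 \<le> c;
    s 0 \<Longrightarrow> admissible (\<lambda>n. s (Suc n)) (a - c) c b;
    \<not> s 0 \<Longrightarrow> admissible (\<lambda>n. s (Suc n)) b a (c - a)\<rbrakk> \<Longrightarrow> admissible s a b c"

lemma admissible_nonneg:
  assumes "admissible s a b c"
  shows "0 \<le> a" "0 \<le> b" "0 \<le> c"
  using assms by (auto elim: admissible.cases)

lemma admissible_True:
  assumes "admissible s a b c" "s 0"
  shows "admissible (\<lambda>n. s (Suc n)) (a - c) c b"
  using assms by (auto elim: admissible.cases)

lemma admissible_False:
  assumes "admissible s a b c" "\<not> s 0"
  shows "admissible (\<lambda>n. s (Suc n)) b a (c - a)"
  using assms by (auto elim: admissible.cases)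

text \<open>Swapping the first and third coordinates conjugates one kind of step into the other.
  This symmetry saves half of the later cases.\<close>

lemma admissible_mirror:
  assumes "admissible s a b c"
  shows "admissible (\<lambda>n. \<not> s n) c b a"
proof -
  have mirror: "\<exists>s'. s = (\<lambda>n. \<not> s' n) \<and> admissible s' c b a \<Longrightarrow> admissible s a b c" for s a b c
  proof (coinduction arbitrary: s a b c)
    case admissible
    then obtain s' where s': "s = (\<lambda>n. \<not> s' n)" "admissible s' c b a" by blast
    have "\<exists>s''. (\<lambda>n. s (Suc n)) = (\<lambda>n. \<not> s'' n) \<and> admissible s'' b c (a - c)" if "s 0"
      using admissible_False[OF s'(2)] that s'(1) by (intro exI[of _ "\<lambda>n. s' (Suc n)"]) simp
    moreover have "\<exists>s''. (\<lambda>n. s (Suc n)) = (\<lambda>n. \<not> s'' n) \<and> admissible s'' (c - a) a b" if "\<not> s 0"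
      using admissible_True[OF s'(2)] that s'(1) by (intro exI[of _ "\<lambda>n. s' (Suc n)"]) simp
    ultimately show ?case using admissible_nonneg[OF s'(2)] by simp
  qed
  show ?thesis by (rule mirror) (use assms in blast)
qed

text \<open>Two equal steps keep the middle coordinate in place; only one outer coordinate
  decreases, by the sum of the other two.\<close>

lemma admissible_True_True:
  assumes "admissible s a b c" "s 0" "s 1"
  shows "admissible (\<lambda>n. s (Suc (Suc n))) (a - c - b) b c"
  using admissible_True[OF admissible_True[OF assms(1,2)]] assms(3) by simp

lemma admissible_False_False:
  assumes "admissible s a b c" "\<not> s 0" "\<not> s 1"
  shows "admissible (\<lambda>n. s (Suc (Suc n))) a b (c - a - b)"
  using admissible_False[OF admissible_False[OF assms(1,2)]] assms(3) by simp

lemma admissible_True_False: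
  assumes "admissible s a b c" "s 0" "\<not> s 1"
  shows "admissible (\<lambda>n. s (Suc (Suc n))) c (a - c) (b - (a - c))"
  using admissible_False[OF admissible_True[OF assms(1,2)]] assms(3) by simp

lemma admissible_constant_True_mult:
  assumes "admissible s a b c" "\<And>n. s n"
  shows "real k * (b + c) \<le> a"
  using assms
proof (induction k arbitrary: s a)
  case 0
  then show ?case using admissible_nonneg by auto
next
  case (Suc k)
  have "real k * (b + c) \<le> a - c - b"
    by (rule Suc.IH[OF admissible_True_True[OF Suc.prems(1)]]) (use Suc.prems(2) in auto)
  then show ?case by (simp add: algebra_simps)
qed

lemma admissible_constant_True:
  assumes "admissible s a b c" "\<And>n. s n"
  shows "b = 0" "c = 0"
proof -
  have "\<not> 0 < b + c"
  proof
    assume "0 < b + c"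
    then obtain k where "a < real k * (b + c)" using reals_Archimedean3 by blast
    then show False using admissible_constant_True_mult[OF assms, of k] by simp
  qed
  then show "b = 0" "c = 0" using admissible_nonneg[OF assms(1)] by linarith+
qed

section \<open>Two orbits of the same sequence\<close>

text \<open>Without denominators: \<open>x\<^sub>1/(x\<^sub>2+x\<^sub>3) \<le> y\<^sub>1/(y\<^sub>2+y\<^sub>3) + 1\<close>. Both quotients count, up to one,
  half the length of the initial run of \<open>C1\<close>.\<close>

lemma first_quotient_le:
  assumes "admissible s x1 x2 x3" "admissible s y1 y2 y3" "\<not> s m"
  shows "x1 * (y2 + y3) \<le> (y1 + y2 + y3) * (x2 + x3)"
  using assms
proof (induction m arbitrary: s x1 y1 rule: less_induct)
  case (less m)
  note nn = admissible_nonneg[OF less.prems(1)] admissible_nonneg[OF less.prems(2)]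
  show ?case
  proof (cases "s 0 \<and> s 1")
    case True
    with less.prems(3) have "m \<noteq> 0" "m \<noteq> 1" by metis+
    then obtain m' where m: "m = Suc (Suc m')" by (metis One_nat_def not0_implies_Suc)
    \<comment> \<open>Two \<open>C1\<close> steps lower both quotients by exactly one, so the claim
      is unchanged while \<open>m\<close> drops by two.\<close>
    have "(x1 - x3 - x2) * (y2 + y3) \<le> (y1 - y3 - y2 + y2 + y3) * (x2 + x3)"
      by (rule less.IH[of m', OF _ admissible_True_True[OF less.prems(1)]
            admissible_True_True[OF less.prems(2)]])
        (use True m less.prems(3) in auto)
    then show ?thesis by (simp add: algebra_simps)
  next
    case False
    \<comment> \<open>The run ends within two steps: the x-quotient is at most one.\<close>
    have "x1 \<le> x2 + x3"
    proof (cases "s 0")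
      case True
      then show ?thesis
        using admissible_nonneg(3)[OF admissible_True_False[OF less.prems(1)]] False by auto
    next
      case False
      then show ?thesis
        using admissible_nonneg(3)[OF admissible_False[OF less.prems(1)]] nn by auto
    qed
    then have "x1 * (y2 + y3) \<le> (x2 + x3) * (y2 + y3)"
      using nn by (intro mult_right_mono) auto
    also have "\<dots> \<le> (y1 + y2 + y3) * (x2 + x3)"
      using nn by (simp add: algebra_simps)
    finally show ?thesis .
  qed
qed

lemma third_quotient_le:
  assumes "admissible s x1 x2 x3" "admissible s y1 y2 y3" "s m"
  shows "x3 * (y1 + y2) \<le> (y1 + y2 + y3) * (x1 + x2)"
  using first_quotient_le[OF assms(1,2)[THEN admissible_mirror], of m] assms(3)
  by (simp add: algebra_simps)

definition recurrent :: "(nat \<Rightarrow> bool) \<Rightarrow> bool" where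
  "recurrent s \<longleftrightarrow> (\<forall>n. \<exists>m\<ge>n. s m) \<and> (\<forall>n. \<exists>m\<ge>n. \<not> s m)"

lemma recurrent_Suc: "recurrent s \<Longrightarrow> recurrent (\<lambda>n. s (Suc n))"
  unfolding recurrent_def by (metis Suc_le_D Suc_le_mono)

lemma recurrent_mirror: "recurrent s \<Longrightarrow> recurrent (\<lambda>n. \<not> s n)"
  unfolding recurrent_def by auto

lemma first_quotient_le_recurrent:
  assumes "recurrent s" "admissible s x1 x2 x3" "admissible s y1 y2 y3"
  shows "x1 * (y2 + y3) \<le> (y1 + y2 + y3) * (x2 + x3)"
  using first_quotient_le[OF assms(2,3)] assms(1) unfolding recurrent_def by blast

lemma third_quotient_le_recurrent:
  assumes "recurrent s" "admissible s x1 x2 x3" "admissible s y1 y2 y3"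
  shows "x3 * (y1 + y2) \<le> (y1 + y2 + y3) * (x1 + x2)"
  using third_quotient_le[OF assms(2,3)] assms(1) unfolding recurrent_def by blast

text \<open>After the \<open>C1\<close> step, \<open>x2\<close> is the third coordinate and the
  other two add up to \<open>x1\<close>. Hence the third quotients, with the roles of
  \<open>x\<close> and \<open>y\<close> exchanged, involve only the first two old coordinates and
  give \<open>x1 * y2 \<le> (x1 + x2) * y1\<close>.\<close>

lemma middle_le_if_True:
  assumes s: "recurrent s" "s 0" and x: "admissible s x1 x2 x3" and y: "admissible s y1 y2 y3"
    and pos: "0 < x1" "0 < y2" and ratio: "10 * (x2 * y1) \<le> x1 * y2"
  shows "9 * x2 \<le> x1"
proof -
  have "y2 * (x1 - x3 + x3) \<le> (x1 - x3 + x3 + x2) * (y1 - y3 + y3)"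
    by (rule third_quotient_le_recurrent[OF recurrent_Suc[OF s(1)]
          admissible_True[OF y s(2)] admissible_True[OF x s(2)]])
  then have le: "x1 * y2 \<le> x1 * y1 + x2 * y1" by (simp add: algebra_simps)
  have "y1 \<noteq> 0" using le mult_pos_pos[OF pos] by auto
  then have "0 < y1" using admissible_nonneg[OF y] by simp
  moreover have "(9 * x2) * y1 \<le> x1 * y1" using le ratio by (simp add: algebra_simps)
  ultimately show ?thesis by simp
qed

text \<open>Under these hypotheses the same situation, possibly mirrored, recurs two steps later with
  unchanged middle coordinates, while \<open>y1 + y3\<close> decreases by at least \<open>y2\<close>.\<close>

lemma middle_trapped:
  assumes "recurrent s" "admissible s x1 x2 x3" "admissible s y1 y2 y3"
    and "0 < y2" "10 * (x2 * y1) \<le> x1 * y2" "2 * x2 < x1" "y1 + y3 \<le> real k * y2"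
  shows False
  using assms
proof (induction k arbitrary: s x1 x3 y1 y3 rule: less_induct)
  case (less k)
  note s = less.prems(1) and x = less.prems(2) and y = less.prems(3) and y2 = less.prems(4)
    and ratio = less.prems(5) and gap = less.prems(6) and size = less.prems(7)
  note nn = admissible_nonneg[OF x] admissible_nonneg[OF y]
  have x1: "0 < x1" using gap nn by linarith
  have s2: "recurrent (\<lambda>n. s (Suc (Suc n)))" using recurrent_Suc[OF recurrent_Suc[OF s]] .
  \<comment> \<open>A drop of \<open>y1 + y3\<close> by \<open>y2\<close> allows
    \<open>k - 1\<close> in place of \<open>k\<close>; nonnegativity of the new sum forces
    \<open>0 < k\<close>.\<close>
  have IH: False if "recurrent s'" "admissible s' x1' x2 x3'" "admissible s' y1' y2 y3'"
     "10 * (x2 * y1') \<le> x1' * y2" "2 * x2 < x1'" "y1' + y3' \<le> y1 + y3 - y2"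
   for s' x1' x3' y1' y3'
  proof (rule less.IH[OF _ that(1-3) y2 that(4,5)])
    have "0 \<le> y1' + y3'" using admissible_nonneg[OF that(3)] by simp
    then have "y2 \<le> real k * y2" using size that(6) by linarith
    then have k: "0 < k" using y2 by (cases k) auto
    then show "k - 1 < k" by simp
    show "y1' + y3' \<le> real (k - 1) * y2"
      using size that(6) k by (simp add: of_nat_diff algebra_simps)
  qed
  show False
  proof (cases "s 0")
    case s0: True
    have big: "9 * x2 \<le> x1" by (rule middle_le_if_True[OF s s0 x y x1 y2 ratio])
    have y31: "y3 \<le> y1" using admissible_nonneg(1)[OF admissible_True[OF y s0]] by simp
    show False
    proof (cases "s 1")
      case s1: True
      note x' = admissible_True_True[OF x s0 s1] and y' = admissible_True_True[OF y s0 s1]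
      note nn' = admissible_nonneg[OF x'] admissible_nonneg[OF y']
      \<comment> \<open>Here \<open>z\<close> will be one new outer coordinate, the other being at
        most \<open>2 * x2\<close>. The premises give \<open>z \<le> 3/10 * x1\<close> and
        \<open>3 * x2 \<le> x1/3\<close>, which add up to less than \<open>x1\<close>.\<close>
      have close: "x1 \<le> 3 * x2 + z \<Longrightarrow> z * y2 \<le> 3 * (x2 * y1) \<Longrightarrow> False" for z
      proof -
        assume z: "x1 \<le> 3 * x2 + z" "z * y2 \<le> 3 * (x2 * y1)"
        have "(10 * z) * y2 \<le> (3 * x1) * y2" using z(2) ratio by (simp add: algebra_simps)
        then have "10 * z \<le> 3 * x1" using y2 by simp
        then show False using z(1) big x1 by linarith
      qed
      \<comment> \<open>The new outer coordinates sum to \<open>x1 - x2\<close> for \<open>x\<close>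
        and \<open>y1 - y2\<close> for \<open>y\<close>, so at least one of them inherits the ratio;
        the third one is handled by mirroring.\<close>
      consider "10 * (x2 * (y1 - y3 - y2)) \<le> (x1 - x3 - x2) * y2" | "10 * (x2 * y3) \<le> x3 * y2"
      proof -
        have "10 * (x2 * (y1 - y3 - y2)) + 10 * (x2 * y3) \<le> (x1 - x3 - x2) * y2 + x3 * y2"
          using ratio mult_nonneg_nonneg[OF nn(2,5)] by (simp add: algebra_simps)
        then show ?thesis using that by linarith
      qed
      then show False
      proof cases
        case 1
        \<comment> \<open>If the gap were lost, the third-quotient bound would make
          \<open>x3\<close> small as well, leaving nothing to account for \<open>x1\<close>.\<close>
        have "2 * x2 < x1 - x3 - x2"
        proof (rule ccontr)
          assume not: "\<not> ?thesis"
          have "x3 * y2 \<le> x3 * (y1 - y3 - y2 + y2)"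
            using nn nn' by (intro mult_left_mono) auto
          also have "\<dots> \<le> (y1 - y3 - y2 + y2 + y3) * (x1 - x3 - x2 + x2)"
            by (rule third_quotient_le_recurrent[OF s2 x' y'])
          also have "\<dots> \<le> y1 * (3 * x2)"
            using not nn nn' by (intro mult_mono) auto
          finally show False using close[of x3] not by (simp add: algebra_simps)
        qed
        then show False using IH[OF s2 x' y' 1] nn by simp
      next
        case 2
        have "2 * x2 < x3"
        proof (rule ccontr)
          assume not: "\<not> ?thesis"
          have "(x1 - x3 - x2) * y2 \<le> (x1 - x3 - x2) * (y2 + y3)"
            using nn nn' by (intro mult_left_mono) auto
          also have "\<dots> \<le> (y1 - y3 - y2 + y2 + y3) * (x2 + x3)"
            by (rule first_quotient_le_recurrent[OF s2 x' y'])
          also have "\<dots> \<le> y1 * (3 * x2)"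
            using not nn nn' by (intro mult_mono) auto
          finally show False using close[of "x1 - x3 - x2"] not by (simp add: algebra_simps)
        qed
        then show False
          using IH[OF recurrent_mirror[OF s2] admissible_mirror[OF x'] admissible_mirror[OF y'] 2] nn
          by simp
      qed
    next
      case s1: False
      note x' = admissible_True_False[OF x s0 s1] and y' = admissible_True_False[OF y s0 s1]
      \<comment> \<open>After these two steps the second and third coordinates add up to the old
        middle one, so the quotient bound compares \<open>x3/x2\<close> with
        \<open>y3/y2\<close>.\<close>
      have "x3 * y2 \<le> (y3 + y2) * x2"
        using first_quotient_le_recurrent[OF s2 x' y'] by (simp add: add.commute)
      also have "\<dots> \<le> (y1 + y2) * x2"
        using y31 nn by (intro mult_right_mono) auto
      finally have 1: "x3 * y2 \<le> (y1 + y2) * x2" .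
      have "(x1 - x2) * y2 \<le> x3 * y2"
        using admissible_nonneg(3)[OF x'] y2 by (intro mult_right_mono) auto
      with 1 ratio have "(9 * x1) * y2 \<le> (20 * x2) * y2" by (simp add: algebra_simps)
      then show False using y2 big x1 by simp
    qed
  next
    case s0: False
    note x' = admissible_False[OF x s0] and y' = admissible_False[OF y s0]
    show False
    proof (cases "s 1")
      case s1: True
      have "x1 * y2 \<le> (y1 + y2) * x2"
        using third_quotient_le_recurrent[OF s2 admissible_True[OF x'] admissible_True[OF y']] s1
        by (simp add: algebra_simps)
      with ratio have "(9 * x1) * y2 \<le> (10 * x2) * y2" by (simp add: algebra_simps)
      then show False using y2 gap x1 by simp
    next
      case s1: False
      show False
        using IH[OF s2 admissible_False_False[OF x s0 s1] admissible_False_False[OF y s0 s1] ratio gap]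
          nn by simp
    qed
  qed
qed

section \<open>The cross ratio bound\<close>

lemma cross_ratio_12:
  assumes s: "recurrent s" and x: "admissible s x1 x2 x3" and y: "admissible s y1 y2 y3"
  shows "x1 * y2 \<le> 10 * (x2 * y1)"
proof (rule ccontr)
  assume "\<not> ?thesis"
  then have ratio: "10 * (x2 * y1) \<le> x1 * y2" and strict: "10 * (x2 * y1) < x1 * y2" by auto
  note nn = admissible_nonneg[OF x] admissible_nonneg[OF y]
  have "0 < x1 * y2" using strict mult_nonneg_nonneg[OF nn(2,4)] by linarith
  then have x1: "0 < x1" and y2: "0 < y2" using nn by (auto simp: zero_less_mult_iff)
  have trapped: False
    if hyps: "recurrent s'" "admissible s' a1 a2 a3" "admissible s' b1 b2 b3"
      "0 < b2" "10 * (a2 * b1) \<le> a1 * b2" "2 * a2 < a1" for s' a1 a2 a3 b1 b2 b3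
  proof -
    obtain k where "b1 + b3 < real k * b2" using reals_Archimedean3[OF hyps(4)] by blast
    then show False using middle_trapped[OF hyps, of k] by simp
  qed
  \<comment> \<open>Otherwise \<open>x\<close> and \<open>y\<close> would satisfy the hypotheses of
    \<open>middle_trapped\<close>; some \<open>k\<close> always exists because \<open>y2\<close> is
    positive.\<close>
  have le: "x1 \<le> 2 * x2" using trapped[OF s x y y2 ratio] by fastforce
  show False
  proof (cases "s 0")
    case True
    then show False using middle_le_if_True[OF s True x y x1 y2 ratio] le x1 by linarith
  next
    case False
    have "10 * (x2 * y1) < (2 * x2) * y2"
      using strict mult_right_mono[OF le, of y2] y2 by linarith
    then have "x2 * (10 * y1) < x2 * (2 * y2)" by (simp add: algebra_simps)
    then have "2 * y1 < y2" using nn by (auto simp: mult_less_cancel_left)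
    \<comment> \<open>A \<open>C2\<close> step exchanges the first two coordinates. The violated
      bound then reads the same with \<open>x\<close> and \<open>y\<close> exchanged, and
      \<open>2 * y1 < y2\<close> supplies the gap.\<close>
    then show False
      using trapped[OF recurrent_Suc[OF s] admissible_False[OF y False] admissible_False[OF x False]]
        x1 ratio by (simp add: algebra_simps)
  qed
qed

lemma cross_ratio_21:
  assumes "recurrent s" "admissible s x1 x2 x3" "admissible s y1 y2 y3"
  shows "x2 * y1 \<le> 10 * (x1 * y2)"
  using cross_ratio_12[OF assms(1,3,2)] by (simp add: algebra_simps)

lemma cross_ratio_32:
  assumes "recurrent s" "admissible s x1 x2 x3" "admissible s y1 y2 y3"
  shows "x3 * y2 \<le> 10 * (x2 * y3)"
  using cross_ratio_12[OF recurrent_mirror[OF assms(1)] assms(2,3)[THEN admissible_mirror]] .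

lemma cross_ratio_23:
  assumes "recurrent s" "admissible s x1 x2 x3" "admissible s y1 y2 y3"
  shows "x2 * y3 \<le> 10 * (x3 * y2)"
  using cross_ratio_32[OF assms(1,3,2)] by (simp add: algebra_simps)

text \<open>One step moves the smaller outer coordinate to the middle and leaves the difference next
  to it, which reduces the bound to adjacent coordinates.\<close>

lemma cross_ratio_13:
  assumes s: "recurrent s" and x: "admissible s x1 x2 x3" and y: "admissible s y1 y2 y3"
  shows "x1 * y3 \<le> 10 * (x3 * y1)"
proof (cases "s 0")
  case True
  have "(x1 - x3) * y3 \<le> 10 * (x3 * (y1 - y3))"
    by (rule cross_ratio_12[OF recurrent_Suc[OF s] admissible_True[OF x True]
          admissible_True[OF y True]])
  moreover have "0 \<le> x3 * y3" using admissible_nonneg x y by simp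
  ultimately show ?thesis by (simp add: algebra_simps)
next
  case False
  have "x1 * (y3 - y1) \<le> 10 * ((x3 - x1) * y1)"
    by (rule cross_ratio_23[OF recurrent_Suc[OF s] admissible_False[OF x False]
          admissible_False[OF y False]])
  moreover have "0 \<le> x1 * y1" using admissible_nonneg x y by simp
  ultimately show ?thesis by (simp add: algebra_simps)
qed

lemma cross_ratio_31:
  assumes "recurrent s" "admissible s x1 x2 x3" "admissible s y1 y2 y3"
  shows "x3 * y1 \<le> 10 * (x1 * y3)"
  using cross_ratio_13[OF assms(1,3,2)] by (simp add: algebra_simps)

section \<open>The limit cone\<close>

lemma nonneg_orthant_3: "v \<in> nonneg_orthant \<longleftrightarrow> 0 \<le> v $ 1 \<and> 0 \<le> v $ 2 \<and> 0 \<le> v $ 3"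
  by (simp add: nonneg_orthant_def forall_3)

lemma linear_inv_step: "linear (inv_step b)"
  by (rule linearI) (auto simp: inv_step_def vec_eq_iff forall_3 algebra_simps)

lemma linear_orb: "linear (orb s n)"
proof (induction n)
  case 0
  then show ?case by (simp add: linear_id[unfolded id_def])
next
  case (Suc n)
  then show ?case using linear_compose[OF Suc linear_inv_step] by (simp add: o_def)
qed

text \<open>Undoing a step only permutes and adds coordinates, so nonnegativity passes to earlier
  times and the cones are nested.\<close>

lemma orb_nonneg_antimono:
  assumes "m \<le> n" "orb s n v \<in> nonneg_orthant"
  shows "orb s m v \<in> nonneg_orthant"
  using assms
proof (induction n rule: dec_induct)
  case base
  then show ?case .
next
  case (step n)
  then show ?case by (auto simp: nonneg_orthant_3 inv_step_def split: if_splits)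
qed

lemma orb_Suc_shift: "orb s (Suc n) v = orb (\<lambda>n. s (Suc n)) n (inv_step (s 0) v)"
  by (induction n) auto

text \<open>The intersection of the theorem, expressed through inverse orbits instead of
  images.\<close>

definition limit_cone :: "(nat \<Rightarrow> bool) \<Rightarrow> (real^3) set" where
  "limit_cone s = {v. \<forall>n. orb s n v \<in> nonneg_orthant}"

lemma limit_cone_nonneg: "v \<in> limit_cone s \<Longrightarrow> 0 \<le> v $ i"
  unfolding limit_cone_def nonneg_orthant_def by (metis (mono_tags, lifting) mem_Collect_eq orb.simps(1))

lemma limit_cone_inv_step:
  "v \<in> limit_cone s \<Longrightarrow> inv_step (s 0) v \<in> limit_cone (\<lambda>n. s (Suc n))"
  unfolding limit_cone_def by (auto simp: orb_Suc_shift simp del: orb.simps(2) dest: spec[of _ "Suc _"])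

lemma limit_cone_admissible:
  assumes "v \<in> limit_cone s"
  shows "admissible s (v $ 1) (v $ 2) (v $ 3)"
proof -
  have "\<exists>v\<in>limit_cone s. a = v $ 1 \<and> b = v $ 2 \<and> c = v $ 3 \<Longrightarrow> admissible s a b c" for s a b c
  proof (coinduction arbitrary: s a b c)
    case admissible
    then obtain v where v: "v \<in> limit_cone s" "a = v $ 1" "b = v $ 2" "c = v $ 3" by blast
    have "inv_step (s 0) v \<in> limit_cone (\<lambda>n. s (Suc n))" using limit_cone_inv_step[OF v(1)] .
    then show ?case
      using v limit_cone_nonneg[OF v(1)] by (auto simp: inv_step_def intro!: bexI)
  qed
  with assms show ?thesis by blast
qed

lemma limit_cone_orb:
  assumes "v \<in> limit_cone s"
  shows "orb s n v \<in> limit_cone (\<lambda>m. s (m + n))"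
proof (induction n)
  case 0
  then show ?case using assms by simp
next
  case (Suc n)
  then show ?case using limit_cone_inv_step[OF Suc] by simp
qed

lemma recurrent_add: "recurrent s \<Longrightarrow> recurrent (\<lambda>m. s (m + n))"
  by (induction n) (auto dest: recurrent_Suc)

lemma limit_cone_cross_ratio:
  assumes "recurrent s" "x \<in> limit_cone s" "y \<in> limit_cone s"
  shows "orb s n x $ j * orb s n y $ i \<le> 10 * (orb s n x $ i * orb s n y $ j)"
proof -
  note c = recurrent_add[OF assms(1)] limit_cone_admissible[OF limit_cone_orb[OF assms(2)]]
    limit_cone_admissible[OF limit_cone_orb[OF assms(3)]]
  have "0 \<le> orb s n x $ k * orb s n y $ k" for k
    using assms(2,3) by (simp add: limit_cone_def nonneg_orthant_def)
  then show ?thesis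
    using exhaust_3[of i] exhaust_3[of j]
      cross_ratio_12[OF c] cross_ratio_21[OF c] cross_ratio_13[OF c]
      cross_ratio_31[OF c] cross_ratio_23[OF c] cross_ratio_32[OF c]
    by auto
qed

section \<open>Closedness of the limit cone and parallelism of its vectors\<close>

lemma closed_nonneg_orthant: "closed nonneg_orthant"
  unfolding nonneg_orthant_def by (intro closed_Collect_all closed_Collect_le continuous_intros)

lemma closed_orb_nonneg: "closed {v. orb s n v \<in> nonneg_orthant}"
  using continuous_closed_vimage[OF closed_nonneg_orthant, of "orb s n"]
    linear_continuous_at[OF linear_orb[unfolded linear_conv_bounded_linear]]
  by (auto simp: vimage_def)

lemma closed_limit_cone: "closed (limit_cone s)"
  unfolding limit_cone_def by (intro closed_Collect_all closed_orb_nonneg)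

lemma limit_cone_scaleR: "v \<in> limit_cone s \<Longrightarrow> 0 \<le> c \<Longrightarrow> c *\<^sub>R v \<in> limit_cone s"
  unfolding limit_cone_def by (auto simp: linear_cmul[OF linear_orb] nonneg_orthant_def)

lemma limit_cone_parallel_recurrent:
  assumes s: "recurrent s" and x: "x \<in> limit_cone s" and y: "y \<in> limit_cone s" "y \<noteq> 0"
  shows "\<exists>c. x = c *\<^sub>R y"
proof -
  define T where "T = {t. x - t *\<^sub>R y \<in> limit_cone s}"
  obtain k where k: "0 < y $ k"
    using y limit_cone_nonneg[OF y(1)] by (metis less_eq_real_def vec_eq_iff zero_index)
  have "t \<le> x $ k / y $ k" if "t \<in> T" for t
    using that limit_cone_nonneg[of "x - t *\<^sub>R y" s k] k by (simp add: T_def field_simps)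
  then have bdd: "bdd_above T" by (rule bdd_aboveI)
  have "closed ((\<lambda>t. x - t *\<^sub>R y) -` limit_cone s)"
    by (intro continuous_closed_vimage closed_limit_cone continuous_intros)
  then have "closed T" by (simp add: T_def vimage_def)
  moreover have "0 \<in> T" using x by (simp add: T_def)
  ultimately have Sup: "Sup T \<in> T" using bdd by (intro closed_contains_Sup) auto
  define z where "z = x - Sup T *\<^sub>R y"
  have z: "z \<in> limit_cone s" using Sup by (simp add: T_def z_def)
  have "z = 0"
  proof (rule ccontr)
    assume "z \<noteq> 0"
    then obtain l where l: "0 < z $ l"
      using limit_cone_nonneg[OF z] by (metis less_eq_real_def vec_eq_iff zero_index)
    \<comment> \<open>The summand 1 covers \<open>y $ l = 0\<close> and makes
      \<open>c * y $ l < z $ l\<close> strict.\<close>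
    define c where "c = z $ l / (y $ l + 1)"
    have yl: "0 \<le> y $ l" using limit_cone_nonneg[OF y(1)] .
    have c: "0 < c" "c * y $ l < z $ l" using l yl by (auto simp: c_def field_simps)
    have "orb s n (z - (c / 10) *\<^sub>R y) \<in> nonneg_orthant" for n
    proof -
      \<comment> \<open>At time 0 the coordinate \<open>l\<close> is negative, and nonnegativity at
        time \<open>n\<close> would pull back. So at each time \<open>z\<close> exceeds
        \<open>c\<close> times \<open>y\<close> in some coordinate \<open>j\<close>, depending on
        \<open>n\<close>.\<close>
      have "orb s n (c *\<^sub>R y - z) \<notin> nonneg_orthant"
      proof
        assume "orb s n (c *\<^sub>R y - z) \<in> nonneg_orthant"
        then have "orb s 0 (c *\<^sub>R y - z) \<in> nonneg_orthant" by (rule orb_nonneg_antimono[rotated]) simp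
        then show False using c by (auto simp: nonneg_orthant_def dest: spec[of _ l])
      qed
      then obtain j where j: "c * orb s n y $ j < orb s n z $ j"
        by (auto simp: nonneg_orthant_def linear_diff[OF linear_orb] linear_cmul[OF linear_orb] not_le)
      have nn: "0 \<le> orb s n y $ i" "0 \<le> orb s n z $ i" for i
        using y z by (auto simp: limit_cone_def nonneg_orthant_def)
      \<comment> \<open>The cross ratio bound spreads the domination from \<open>j\<close> to every
        \<open>i\<close>, at the cost of the factor 10.\<close>
      have "c * orb s n y $ i \<le> 10 * orb s n z $ i" for i
      proof (cases "orb s n y $ j = 0")
        case True
        then have "orb s n z $ j * orb s n y $ i \<le> 0"
          using limit_cone_cross_ratio[OF s z y(1), of n j i] by simp
        moreover have "0 < orb s n z $ j" using True j by simp
        ultimately have "orb s n y $ i \<le> 0" by (simp add: mult_le_0_iff)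
        then show ?thesis using nn[of i] by simp
      next
        case False
        then have yj: "0 < orb s n y $ j" using nn[of j] by simp
        have "(c * orb s n y $ j) * orb s n y $ i \<le> orb s n z $ j * orb s n y $ i"
          using j nn by (intro mult_right_mono) auto
        also have "\<dots> \<le> 10 * (orb s n z $ i * orb s n y $ j)"
          by (rule limit_cone_cross_ratio[OF s z y(1)])
        finally have "(c * orb s n y $ i) * orb s n y $ j \<le> (10 * orb s n z $ i) * orb s n y $ j"
          by (simp add: algebra_simps)
        then show ?thesis using yj by simp
      qed
      then show ?thesis
        by (auto simp: nonneg_orthant_def linear_diff[OF linear_orb] linear_cmul[OF linear_orb] field_simps)
    qed
    then have "Sup T + c / 10 \<in> T"
      by (simp add: T_def limit_cone_def z_def algebra_simps)
    then have "Sup T + c / 10 \<le> Sup T" using bdd by (rule cSup_upper)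
    then show False using c by simp
  qed
  then show ?thesis by (auto simp: z_def)
qed

lemma inj_orb: "inj (orb s n)"
proof (induction n)
  case 0
  then show ?case by (simp add: inj_def)
next
  case (Suc n)
  have "inj (inv_step (s n))"
    by (rule injI) (simp add: inv_step_def vec_eq_iff forall_3 split: if_splits)
  then have "inj (inv_step (s n) \<circ> orb s n)" using Suc by (rule inj_compose)
  then show ?case by (simp add: o_def)
qed

text \<open>From time \<open>N\<close> on only coordinate \<open>l\<close> can be nonzero, so the
  vectors are parallel there; injectivity of \<open>orb\<close> carries this back to time 0.\<close>

lemma limit_cone_parallel_constant:
  assumes const: "\<And>m. s (m + N) = b" and x: "x \<in> limit_cone s" and y: "y \<in> limit_cone s" "y \<noteq> 0"
  shows "\<exists>c. x = c *\<^sub>R y"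
proof -
  define l :: 3 where "l = (if b then 1 else 3)"
  have zero: "orb s N v $ i = 0" if v: "v \<in> limit_cone s" and i: "i \<noteq> l" for v i
  proof -
    have adm: "admissible (\<lambda>m. b) (orb s N v $ 1) (orb s N v $ 2) (orb s N v $ 3)"
      using limit_cone_admissible[OF limit_cone_orb[OF v, of N]] const by simp
    show ?thesis
      using admissible_constant_True[OF adm] admissible_constant_True[OF admissible_mirror[OF adm]]
        exhaust_3[of i] i by (cases b) (auto simp: l_def)
  qed
  have "orb s N y \<noteq> 0"
    using y(2) injD[OF inj_orb, of s N y 0] linear_0[OF linear_orb] by auto
  then have yl: "orb s N y $ l \<noteq> 0" using zero[OF y(1)] by (metis vec_eq_iff zero_index)
  define c where "c = orb s N x $ l / orb s N y $ l"
  have "orb s N x $ i = c * orb s N y $ i" for i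
    using zero[OF x, of i] zero[OF y(1), of i] yl by (cases "i = l") (auto simp: c_def)
  then have "orb s N x = orb s N (c *\<^sub>R y)"
    by (simp add: vec_eq_iff linear_cmul[OF linear_orb])
  then show ?thesis using injD[OF inj_orb] by blast
qed

lemma limit_cone_parallel:
  assumes x: "x \<in> limit_cone s" and y: "y \<in> limit_cone s" "y \<noteq> 0"
  shows "\<exists>c. x = c *\<^sub>R y"
proof (cases "recurrent s")
  case True
  then show ?thesis using limit_cone_parallel_recurrent x y by blast
next
  case False
  then consider N where "\<forall>m\<ge>N. \<not> s m" | N where "\<forall>m\<ge>N. s m" unfolding recurrent_def by blast
  then show ?thesis
  proof cases
    case (1 N)
    then show ?thesis using limit_cone_parallel_constant[of s N False] x y by simp
  next
    case (2 N)
    then show ?thesis using limit_cone_parallel_constant[of s N True] x y by simp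
  qed
qed

section \<open>Matrix products\<close>

context
  fixes M :: "nat \<Rightarrow> real^3^3" and s :: "nat \<Rightarrow> bool"
  assumes M: "\<And>n. M n = (if s n then C1 else C2)"
begin

lemma M_inv_step: "M n *v inv_step (s n) v = v"
  by (simp add: M C1_def C2_def inv_step_def matrix_vector_mult_def vec_eq_iff forall_3 sum_3)

lemma inv_step_M: "inv_step (s n) (M n *v v) = v"
  by (simp add: M C1_def C2_def inv_step_def matrix_vector_mult_def vec_eq_iff forall_3 sum_3)

lemma mat_prod_orb: "mat_prod M n *v orb s n v = v"
  by (induction n) (simp_all add: matrix_vector_mul_assoc[symmetric] M_inv_step)

lemma orb_mat_prod: "orb s n (mat_prod M n *v v) = v"
  by (induction n arbitrary: v) (simp_all add: matrix_vector_mul_assoc[symmetric] inv_step_M)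

lemma mat_prod_image: "(\<lambda>x. mat_prod M n *v x) ` nonneg_orthant = {v. orb s n v \<in> nonneg_orthant}"
proof (intro set_eqI iffI)
  fix v assume "v \<in> {v. orb s n v \<in> nonneg_orthant}"
  then show "v \<in> (\<lambda>x. mat_prod M n *v x) ` nonneg_orthant"
    by (intro image_eqI[where x = "orb s n v"]) (auto simp: mat_prod_orb)
qed (auto simp: orb_mat_prod)

text \<open>The cones are closed and nested, and each contains a unit vector, so compactness of the
  sphere yields a common one.\<close>

lemma limit_cone_nontrivial: "\<exists>u \<in> limit_cone s. u \<noteq> 0"
proof -
  define S where "S n = {v. orb s n v \<in> nonneg_orthant} \<inter> sphere 0 1" for n
  have "\<Inter> (range S) \<noteq> {}"
  proof (rule compact_nest)
    show "compact (S n)" for n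
      unfolding S_def by (rule closed_Int_compact[OF closed_orb_nonneg compact_sphere])
    show "S n \<subseteq> S m" if "m \<le> n" for m n
      using orb_nonneg_antimono[OF that] by (auto simp: S_def)
    show "S n \<noteq> {}" for n
    proof -
      \<comment> \<open>Any nonzero vector of the orthant would do in place of
        \<open>axis 1 1\<close>: its image lies in the cone at time \<open>n\<close> and can be
        normalized.\<close>
      define w where "w = mat_prod M n *v (axis 1 1)"
      have orb: "orb s n w = axis 1 1" by (simp add: w_def orb_mat_prod)
      then have "w \<noteq> 0" using linear_0[OF linear_orb[of s n]] by (auto simp: axis_eq_0_iff)
      then have "(1 / norm w) *\<^sub>R w \<in> S n"
        by (simp add: S_def linear_cmul[OF linear_orb] orb nonneg_orthant_def axis_def)
      then show ?thesis by blast
    qed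
  qed
  then obtain u where "\<And>n. u \<in> S n" by blast
  then show ?thesis by (intro bexI[of _ u]) (auto simp: S_def limit_cone_def)
qed

end

theorem proposition4p4:
  fixes M :: "nat \<Rightarrow> real^3^3"
  assumes "\<And>n. M n \<in> {C1, C2}"
  shows "\<exists>u \<in> nonneg_orthant - {0}.
           (\<Inter>n. (\<lambda>x. mat_prod M n *v x) ` nonneg_orthant) = {c *\<^sub>R u | c. 0 \<le> c}"
proof -
  define s where "s n \<longleftrightarrow> M n = C1" for n
  have M: "M n = (if s n then C1 else C2)" for n using assms[of n] by (auto simp: s_def)
  obtain u where u: "u \<in> limit_cone s" "u \<noteq> 0" using limit_cone_nontrivial[of M s, OF M] by blast
  have nonneg: "u \<in> nonneg_orthant" using limit_cone_nonneg[OF u(1)] by (simp add: nonneg_orthant_def)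
  have "limit_cone s = {c *\<^sub>R u | c. 0 \<le> c}"
  proof (intro set_eqI iffI)
    fix x assume x: "x \<in> limit_cone s"
    then obtain c where c: "x = c *\<^sub>R u" using limit_cone_parallel u by blast
    obtain k where "0 < u $ k"
      using u limit_cone_nonneg[OF u(1)] by (metis less_eq_real_def vec_eq_iff zero_index)
    then have "0 \<le> c" using limit_cone_nonneg[OF x, of k] c by (simp add: zero_le_mult_iff)
    with c show "x \<in> {c *\<^sub>R u | c. 0 \<le> c}" by blast
  qed (use u limit_cone_scaleR in auto)
  moreover have "(\<Inter>n. (\<lambda>x. mat_prod M n *v x) ` nonneg_orthant) = limit_cone s"
    by (auto simp: mat_prod_image[of M s, OF M] limit_cone_def)
  ultimately show ?thesis using nonneg u(2) by auto
qed

end
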